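(* Let $G$ be any group. Suppose $Y \subset A^G$ is a contractible subshift of finite type, and let $X \subset B^G$ be an arbitrary subshift. Then the following are equivalent: (1) There is a block map $f : X \to Y$ and there is a block map $g : X \to A^G$ such that $g(X) \supset Y$. (2) There is a factor map (surjective block map) $X \to Y$.
   Context: $A$ and $B$ are finite sets (alphabets). For a finite set $A$ and a group $G$, $A^G$ carries the product topology (discrete $A$) and the shift action $(gx)_h = x_{g^{-1}h}$. A subshift is a topologically closed, shift-invariant subset of $A^G$. A finite pattern is an element $p \in A^D$ with $D \subset G$ finite; it appears in $x \in A^G$ if for some $g \in G$ one has $x_{gd} = p_d$ for all $d \in D$. A subshift $Y \subset A^G$ is of finite type (SFT) if there is a finite set of finite patterns such that $Y$ is the set of all $x \in A^G$ in which none of them appears. A block map between $G$-subshifts is a continuous shift-commuting map (not necessarily surjective); products carry the diagonal action. Let $I = \{0,1\}^G$, and let $\bar 0, \bar 1 \in I$ be the constant configurations. A subshift $Y$ is contractible if there is a block map $h : I \times Y \times Y \to Y$ with $h(\bar 0, x, y) = x$ and $h(\bar 1, x, y) = y$ for all $x, y \in Y$. *)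

theory Defs
  imports "HOL-Algebra.Group" "HOL-Analysis.Analysis"
begin

text \<open>
  Configurations in \<open>A\<^sup>G\<close> are the extensional functions \<open>carrier G \<rightarrow>\<^sub>E A\<close>, i.e. the points of
  the following product space.
\<close>

definition full_shift :: "('g, 'm) monoid_scheme \<Rightarrow> 'a set \<Rightarrow> ('g \<Rightarrow> 'a) topology" where
  "full_shift G A = product_topology (\<lambda>_. discrete_topology A) (carrier G)"

definition shift :: "('g, 'm) monoid_scheme \<Rightarrow> 'g \<Rightarrow> ('g \<Rightarrow> 'a) \<Rightarrow> 'g \<Rightarrow> 'a" where
  "shift G g x = (\<lambda>h\<in>carrier G. x (inv\<^bsub>G\<^esub> g \<otimes>\<^bsub>G\<^esub> h))"

definition subshift :: "('g, 'm) monoid_scheme \<Rightarrow> 'a set \<Rightarrow> ('g \<Rightarrow> 'a) set \<Rightarrow> bool" where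
  "subshift G A X \<longleftrightarrow>
     closedin (full_shift G A) X \<and> (\<forall>g\<in>carrier G. \<forall>x\<in>X. shift G g x \<in> X)"

text \<open>A finite pattern \<open>p \<in> A\<^sup>D\<close> is stored together with its domain, as the pair \<open>(D, p)\<close>.\<close>

definition finite_patterns ::
    "('g, 'm) monoid_scheme \<Rightarrow> 'a set \<Rightarrow> ('g set \<times> ('g \<Rightarrow> 'a)) set" where
  "finite_patterns G A = {(D, p). finite D \<and> D \<subseteq> carrier G \<and> p \<in> D \<rightarrow>\<^sub>E A}"

definition appears_in ::
    "('g, 'm) monoid_scheme \<Rightarrow> 'g set \<times> ('g \<Rightarrow> 'a) \<Rightarrow> ('g \<Rightarrow> 'a) \<Rightarrow> bool" where
  "appears_in G P x \<longleftrightarrow> (\<exists>g\<in>carrier G. \<forall>d\<in>fst P. x (g \<otimes>\<^bsub>G\<^esub> d) = snd P d)"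

definition SFT :: "('g, 'm) monoid_scheme \<Rightarrow> 'a set \<Rightarrow> ('g \<Rightarrow> 'a) set \<Rightarrow> bool" where
  "SFT G A Y \<longleftrightarrow> subshift G A Y \<and>
     (\<exists>F. finite F \<and> F \<subseteq> finite_patterns G A \<and>
          Y = {x \<in> topspace (full_shift G A). \<forall>P\<in>F. \<not> appears_in G P x})"

text \<open>
  Continuous equivariant maps between spaces \<open>S\<close>, \<open>T\<close> carrying \<open>G\<close>-actions \<open>a\<close>, \<open>b\<close>. Spaces and
  actions are parameters so that products of subshifts with the diagonal action are covered.
\<close>

definition equivariant_map ::
    "('g, 'm) monoid_scheme \<Rightarrow> 'x topology \<Rightarrow> ('g \<Rightarrow> 'x \<Rightarrow> 'x)
      \<Rightarrow> 'y topology \<Rightarrow> ('g \<Rightarrow> 'y \<Rightarrow> 'y) \<Rightarrow> ('x \<Rightarrow> 'y) \<Rightarrow> bool" where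
  "equivariant_map G S a T b f \<longleftrightarrow>
     continuous_map S T f \<and> (\<forall>g\<in>carrier G. \<forall>x\<in>topspace S. f (a g x) = b g (f x))"

definition block_map ::
    "('g, 'm) monoid_scheme \<Rightarrow> 'b set \<Rightarrow> ('g \<Rightarrow> 'b) set \<Rightarrow> 'a set \<Rightarrow> ('g \<Rightarrow> 'a) set
      \<Rightarrow> (('g \<Rightarrow> 'b) \<Rightarrow> ('g \<Rightarrow> 'a)) \<Rightarrow> bool" where
  "block_map G B X A Y f \<longleftrightarrow>
     equivariant_map G (subtopology (full_shift G B) X) (shift G)
       (subtopology (full_shift G A) Y) (shift G) f"

definition factor_map ::
    "('g, 'm) monoid_scheme \<Rightarrow> 'b set \<Rightarrow> ('g \<Rightarrow> 'b) set \<Rightarrow> 'a set \<Rightarrow> ('g \<Rightarrow> 'a) set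
      \<Rightarrow> (('g \<Rightarrow> 'b) \<Rightarrow> ('g \<Rightarrow> 'a)) \<Rightarrow> bool" where
  "factor_map G B X A Y f \<longleftrightarrow> block_map G B X A Y f \<and> f ` X = Y"

definition contractible_subshift ::
    "('g, 'm) monoid_scheme \<Rightarrow> 'a set \<Rightarrow> ('g \<Rightarrow> 'a) set \<Rightarrow> bool" where
  "contractible_subshift G A Y \<longleftrightarrow> subshift G A Y \<and>
     (\<exists>h :: ('g \<Rightarrow> nat) \<times> ('g \<Rightarrow> 'a) \<times> ('g \<Rightarrow> 'a) \<Rightarrow> ('g \<Rightarrow> 'a).
        equivariant_map G
          (prod_topology (full_shift G {0, 1})
            (prod_topology (subtopology (full_shift G A) Y) (subtopology (full_shift G A) Y)))
          (\<lambda>g (i, x, y). (shift G g i, shift G g x, shift G g y))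
          (subtopology (full_shift G A) Y) (shift G) h \<and>
        (\<forall>x\<in>Y. \<forall>y\<in>Y. h ((\<lambda>_\<in>carrier G. 0), x, y) = x \<and> h ((\<lambda>_\<in>carrier G. 1), x, y) = y))"

end

theory Submission imports Defs
begin

text \<open>
  Suppose \<open>f : X \<rightarrow> Y\<close> and \<open>g : X \<rightarrow> A\<^sup>G\<close> with \<open>Y \<subseteq> g(X)\<close>, and let \<open>h\<close> be the contraction. By
  compactness \<open>h(i, y, z)\<^sub>k\<close> depends only on the coordinates in \<open>kN\<close> for a finite \<open>N\<close>, so it makes
  sense as soon as \<open>z\<close> agrees on \<open>kN\<close> with some point of \<open>Y\<close>. Let \<open>i(x)\<^sub>k = 1\<close> if \<open>g(x)\<close> agrees on
  \<open>kM\<close> with a point of \<open>Y\<close>, and \<open>i(x)\<^sub>k = 0\<close> otherwise. The factor map is \<open>x \<mapsto> h(i(x), f(x), g(x))\<close>,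
  read as \<open>f(x)\<^sub>k\<close> at those \<open>k\<close> where \<open>g(x)\<close> is not in \<open>Y\<close> on \<open>kN\<close>. If \<open>M\<close> is large compared to \<open>N\<close>
  and to the window \<open>D\<close> of the forbidden patterns of \<open>Y\<close>, then on each \<open>kD\<close> the image agrees with a
  point of \<open>Y\<close>: with \<open>f(x)\<close> if \<open>i(x)\<close> vanishes on \<open>kDN\<close>, and otherwise with \<open>h(i(x), f(x), z)\<close> for
  some \<open>z \<in> Y\<close>. It is onto because \<open>g(x) \<in> Y\<close> forces \<open>i(x)\<close> to be constantly \<open>1\<close>.
\<close>

section \<open>Continuity into discrete spaces and finite windows\<close>

lemma openin_finite_agreement:
  assumes "finite N" "\<And>n. n \<in> N \<Longrightarrow> continuous_map S (discrete_topology (C n)) (u n)" "x \<in> topspace S"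
  shows "openin S {x' \<in> topspace S. \<forall>n\<in>N. u n x' = u n x}"
proof -
  have "openin S {x' \<in> topspace S. u n x' \<in> {u n x}}" if "n \<in> N" for n
    using assms(3) assms(2)[OF that]
    by (intro openin_continuous_map_preimage[OF assms(2)[OF that]]) (auto simp: continuous_map_def Pi_iff)
  moreover have "{x' \<in> topspace S. \<forall>n\<in>N. u n x' = u n x}
      = (\<Inter>n\<in>N. {x' \<in> topspace S. u n x' \<in> {u n x}}) \<inter> topspace S"
    by auto
  ultimately show ?thesis
    using \<open>finite N\<close> by (cases "N = {}") (auto intro!: openin_Int openin_INT)
qed

text \<open>Around each point of a preimage, the set of points agreeing with it on \<open>N\<close>
  is an open neighbourhood on which \<open>F\<close> is constant. The coordinates \<open>u\<close>
  are abstract so that they can also be values of block maps.\<close>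

lemma continuous_map_discrete_if_finitely_determined:
  assumes "finite N"
    and cont: "\<And>n. n \<in> N \<Longrightarrow> continuous_map S (discrete_topology (C n)) (u n)"
    and det: "\<And>x x'. x \<in> topspace S \<Longrightarrow> x' \<in> topspace S \<Longrightarrow> (\<And>n. n \<in> N \<Longrightarrow> u n x = u n x') \<Longrightarrow> F x = F x'"
    and img: "F \<in> topspace S \<rightarrow> A"
  shows "continuous_map S (discrete_topology A) F"
proof -
  have op: "openin S {x \<in> topspace S. F x \<in> U}" for U
  proof (subst openin_subopen, intro ballI)
    fix x assume x: "x \<in> {x \<in> topspace S. F x \<in> U}"
    let ?W = "{x' \<in> topspace S. \<forall>n\<in>N. u n x' = u n x}"
    have "openin S ?W"
      using x by (intro openin_finite_agreement[OF \<open>finite N\<close> cont]) auto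
    moreover have "?W \<subseteq> {x \<in> topspace S. F x \<in> U}"
    proof
      fix x' assume x': "x' \<in> ?W"
      then have "F x' = F x" using x by (intro det) auto
      then show "x' \<in> {x \<in> topspace S. F x \<in> U}" using x x' by auto
    qed
    ultimately show "\<exists>T. openin S T \<and> x \<in> T \<and> T \<subseteq> {x \<in> topspace S. F x \<in> U}" using x by blast
  qed
  show ?thesis
    using img op by (auto simp: continuous_map_def)
qed

text \<open>The compactness half of the Curtis-Hedlund-Lyndon theorem. The assumption
  \<open>cylinder\<close> says that finite agreement sets form a neighbourhood base, so each point
  has its own finite window. Finitely many of the resulting sets cover the space, and the union of
  their windows works uniformly.\<close>

lemma finitely_determined_if_continuous_map_discrete:
  assumes "compact_space S" "continuous_map S (discrete_topology A) F"
    and cont: "\<And>k. k \<in> K \<Longrightarrow> continuous_map S (discrete_topology (C k)) (u k)"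
    and cylinder: "\<And>U x. openin S U \<Longrightarrow> x \<in> U \<Longrightarrow> \<exists>N. finite N \<and> N \<subseteq> K \<and>
        (\<forall>y\<in>topspace S. (\<forall>n\<in>N. u n y = u n x) \<longrightarrow> y \<in> U)"
  obtains N where "finite N" "N \<subseteq> K"
    "\<And>x y. x \<in> topspace S \<Longrightarrow> y \<in> topspace S \<Longrightarrow> (\<And>n. n \<in> N \<Longrightarrow> u n x = u n y) \<Longrightarrow> F x = F y"
proof -
  have "\<exists>N. finite N \<and> N \<subseteq> K \<and> (\<forall>y\<in>topspace S. (\<forall>n\<in>N. u n y = u n x) \<longrightarrow> F y = F x)"
    if x: "x \<in> topspace S" for x
  proof -
    have "openin S {y \<in> topspace S. F y \<in> {F x}}"
      using assms(2) x by (intro openin_continuous_map_preimage[OF assms(2)]) (auto simp: continuous_map_def Pi_iff)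
    from cylinder[OF this, of x] x show ?thesis by auto
  qed
  then obtain N where N: "\<And>x. x \<in> topspace S \<Longrightarrow> finite (N x) \<and> N x \<subseteq> K \<and>
      (\<forall>y\<in>topspace S. (\<forall>n\<in>N x. u n y = u n x) \<longrightarrow> F y = F x)"
    by metis
  define W where "W x = {y \<in> topspace S. \<forall>n\<in>N x. u n y = u n x}" for x
  have "\<forall>U\<in>W ` topspace S. openin S U"
    unfolding W_def using N cont by (blast intro: openin_finite_agreement)
  moreover have "topspace S \<subseteq> \<Union>(W ` topspace S)" by (auto simp: W_def)
  ultimately obtain \<F> where "finite \<F>" "\<F> \<subseteq> W ` topspace S" "topspace S \<subseteq> \<Union>\<F>"
    using assms(1) unfolding compact_space_alt by meson
  then obtain P where P: "finite P" "P \<subseteq> topspace S" "topspace S \<subseteq> \<Union>(W ` P)"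
    using finite_subset_image[of \<F> W "topspace S"] by metis
  show thesis
  proof
    show "finite (\<Union>(N ` P))" "\<Union>(N ` P) \<subseteq> K" using P N by blast+
    fix x y assume xy: "x \<in> topspace S" "y \<in> topspace S" "\<And>n. n \<in> \<Union>(N ` P) \<Longrightarrow> u n x = u n y"
    obtain p where p: "p \<in> P" "x \<in> W p" using P xy by blast
    then have "y \<in> W p" using xy by (force simp: W_def)
    moreover have "\<forall>z\<in>W p. F z = F p" using N[of p] p(1) P(2) unfolding W_def by blast
    ultimately show "F x = F y" using p(2) by simp
  qed
qed

section \<open>Cylinders, compactness and windows in full shifts and subshifts\<close>

lemma full_shift_cylinder:
  assumes "openin (full_shift G A) U" "x \<in> U"
  obtains N where "finite N" "N \<subseteq> carrier G"
    "\<And>y. y \<in> topspace (full_shift G A) \<Longrightarrow> (\<And>n. n \<in> N \<Longrightarrow> y n = x n) \<Longrightarrow> y \<in> U"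
proof -
  obtain V where V: "finite {k \<in> carrier G. V k \<noteq> A}" "x \<in> Pi\<^sub>E (carrier G) V" "Pi\<^sub>E (carrier G) V \<subseteq> U"
    using openin_product_topology_alt[THEN iffD1, OF assms(1)[unfolded full_shift_def], rule_format, OF assms(2)]
    unfolding topspace_discrete_topology by blast
  show thesis
  proof
    show "finite {k \<in> carrier G. V k \<noteq> A}" by fact
    fix y assume y: "y \<in> topspace (full_shift G A)" "\<And>n. n \<in> {k \<in> carrier G. V k \<noteq> A} \<Longrightarrow> y n = x n"
    have "y k \<in> V k" if "k \<in> carrier G" for k
      using that y(1) y(2)[of k] V(2) by (cases "V k = A") (auto simp: full_shift_def PiE_iff)
    then have "y \<in> Pi\<^sub>E (carrier G) V"
      using y(1) by (simp add: full_shift_def PiE_iff)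
    then show "y \<in> U" using V(3) by blast
  qed auto
qed

lemma continuous_map_full_shift_eval:
  "k \<in> carrier G \<Longrightarrow> continuous_map (full_shift G A) (discrete_topology A) (\<lambda>x. x k)"
  unfolding full_shift_def by (rule continuous_map_product_projection)

lemma continuous_map_into_full_shift:
  "continuous_map S (full_shift G A) f \<longleftrightarrow> f \<in> topspace S \<rightarrow> extensional (carrier G) \<and>
     (\<forall>k\<in>carrier G. continuous_map S (discrete_topology A) (\<lambda>x. f x k))"
  by (auto simp: full_shift_def continuous_map_componentwise)

lemma compact_space_subshift:
  assumes "finite A" "subshift G A Y"
  shows "compact_space (subtopology (full_shift G A) Y)"
  using assms
  by (auto simp: subshift_def full_shift_def compact_space_product_topology compact_space_discrete_topology
      intro!: compact_space_subtopology closedin_compact_space)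

lemma subshift_topspace: "subshift G A Y \<Longrightarrow> Y \<subseteq> topspace (full_shift G A)"
  by (simp add: subshift_def closedin_subset)

lemma topspace_subshift: "subshift G A Y \<Longrightarrow> topspace (subtopology (full_shift G A) Y) = Y"
  using subshift_topspace by force

lemma subshift_shift: "subshift G A Y \<Longrightarrow> g \<in> carrier G \<Longrightarrow> x \<in> Y \<Longrightarrow> shift G g x \<in> Y"
  by (simp add: subshift_def)

text \<open>This gives the contraction a finite window. Reading the three configurations at
  \<open>k\<close> as the single letter \<open>(i k, x k, y k)\<close> lets the abstract compactness
  lemma apply to the product; a cylinder in it is found by uniting the windows of the three
  factors.\<close>

lemma finite_window_triple:
  assumes "finite I" "finite A" "subshift G A Y"
    and F: "continuous_map (prod_topology (full_shift G I)
          (prod_topology (subtopology (full_shift G A) Y) (subtopology (full_shift G A) Y)))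
          (discrete_topology C) F"
  obtains N where "finite N" "N \<subseteq> carrier G"
    "\<And>i j x x' y y'. \<lbrakk>i \<in> topspace (full_shift G I); j \<in> topspace (full_shift G I);
       x \<in> Y; x' \<in> Y; y \<in> Y; y' \<in> Y; \<And>n. n \<in> N \<Longrightarrow> i n = j n \<and> x n = x' n \<and> y n = y' n\<rbrakk>
      \<Longrightarrow> F (i, x, y) = F (j, x', y')"
proof -
  let ?I = "full_shift G I" and ?Y = "subtopology (full_shift G A) Y"
  let ?T = "prod_topology ?I (prod_topology ?Y ?Y)"
  let ?u = "\<lambda>k (i, x, y). (i k, x k, y k)"
  have tY: "topspace ?Y = Y" using assms(3) by (rule topspace_subshift)
  note YA = subshift_topspace[OF assms(3)]
  have comp: "compact_space ?T"
    using assms(1) compact_space_subshift[OF assms(2,3)]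
    by (simp add: compact_space_prod_topology full_shift_def compact_space_product_topology
        compact_space_discrete_topology)
  have cont: "continuous_map ?T (discrete_topology (I \<times> A \<times> A)) (?u k)" if k: "k \<in> carrier G" for k
  proof -
    note ev = continuous_map_full_shift_eval[OF k]
    have "continuous_map ?T (prod_topology (discrete_topology I) (prod_topology (discrete_topology A) (discrete_topology A)))
        (\<lambda>t. (fst t k, fst (snd t) k, snd (snd t) k))"
      using continuous_map_compose[OF continuous_map_fst ev, unfolded o_def]
        continuous_map_compose[OF continuous_map_compose[OF continuous_map_snd continuous_map_fst]
            continuous_map_from_subtopology[OF ev], unfolded o_def]
        continuous_map_compose[OF continuous_map_compose[OF continuous_map_snd continuous_map_snd]
            continuous_map_from_subtopology[OF ev], unfolded o_def]
      by (intro continuous_map_pairedI)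
    then show ?thesis by (simp add: prod_topology_discrete_topology[symmetric] case_prod_beta')
  qed
  have cyl: "\<exists>N. finite N \<and> N \<subseteq> carrier G \<and> (\<forall>s\<in>topspace ?T. (\<forall>n\<in>N. ?u n s = ?u n t) \<longrightarrow> s \<in> U)"
    if U: "openin ?T U" "t \<in> U" for U t
  proof -
    obtain i x y where t: "t = (i, x, y)" by (cases t)
    obtain U1 V where "openin ?I U1" "i \<in> U1" "openin (prod_topology ?Y ?Y) V" "(x, y) \<in> V" and UV: "U1 \<times> V \<subseteq> U"
      using openin_prod_topology_alt[THEN iffD1, OF U(1), rule_format, OF U(2)[unfolded t]] by auto
    then obtain W2 W3 where W: "openin ?Y W2" "x \<in> W2" "openin ?Y W3" "y \<in> W3" "W2 \<times> W3 \<subseteq> V"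
      using openin_prod_topology_alt[THEN iffD1, rule_format, of ?Y ?Y V x y] by auto
    then obtain U2 U3 where U23: "openin (full_shift G A) U2" "W2 = U2 \<inter> Y" "openin (full_shift G A) U3" "W3 = U3 \<inter> Y"
      unfolding openin_subtopology by auto
    obtain N1 where N1: "finite N1" "N1 \<subseteq> carrier G"
      "\<And>j. j \<in> topspace ?I \<Longrightarrow> (\<And>n. n \<in> N1 \<Longrightarrow> j n = i n) \<Longrightarrow> j \<in> U1"
      using full_shift_cylinder[OF \<open>openin ?I U1\<close> \<open>i \<in> U1\<close>] by metis
    obtain N2 where N2: "finite N2" "N2 \<subseteq> carrier G"
      "\<And>j. j \<in> topspace (full_shift G A) \<Longrightarrow> (\<And>n. n \<in> N2 \<Longrightarrow> j n = x n) \<Longrightarrow> j \<in> U2"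
      using full_shift_cylinder[OF U23(1), of x] W U23 by (metis IntD1)
    obtain N3 where N3: "finite N3" "N3 \<subseteq> carrier G"
      "\<And>j. j \<in> topspace (full_shift G A) \<Longrightarrow> (\<And>n. n \<in> N3 \<Longrightarrow> j n = y n) \<Longrightarrow> j \<in> U3"
      using full_shift_cylinder[OF U23(3), of y] W U23 by (metis IntD1)
    have "(j, x', y') \<in> U" if "j \<in> topspace ?I" "x' \<in> Y" "y' \<in> Y"
        "\<forall>n\<in>N1 \<union> N2 \<union> N3. j n = i n \<and> x' n = x n \<and> y' n = y n" for j x' y'
    proof -
      have "j \<in> U1" using that by (intro N1) auto
      moreover have "x' \<in> U2" using that YA by (intro N2) auto
      moreover have "y' \<in> U3" using that YA by (intro N3) auto
      ultimately show ?thesis using that UV W U23 by blast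
    qed
    then have "\<forall>s\<in>topspace ?T. (\<forall>n\<in>N1 \<union> N2 \<union> N3. ?u n s = ?u n t) \<longrightarrow> s \<in> U"
      unfolding t topspace_prod_topology tY by auto
    then show ?thesis using N1 N2 N3 by (intro exI[of _ "N1 \<union> N2 \<union> N3"]) auto
  qed
  show thesis
  proof (rule finitely_determined_if_continuous_map_discrete[OF comp F cont cyl])
    fix N assume N: "finite N" "N \<subseteq> carrier G"
      "\<And>s t. s \<in> topspace ?T \<Longrightarrow> t \<in> topspace ?T \<Longrightarrow> (\<And>n. n \<in> N \<Longrightarrow> ?u n s = ?u n t) \<Longrightarrow> F s = F t"
    show thesis
      by (rule that[OF N(1,2)], rule N(3)) (use YA in auto)
  qed
qed

text \<open>Take for \<open>D\<close> the union of the domains of the forbidden patterns. A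
  forbidden pattern found in \<open>x\<close> at \<open>k\<close> would also appear at
  \<open>k\<close> in the point of \<open>Y\<close> that agrees with \<open>x\<close> there.\<close>

lemma SFT_window:
  assumes "SFT G A Y"
  obtains D where "finite D" "D \<subseteq> carrier G"
    "\<And>x. x \<in> topspace (full_shift G A) \<Longrightarrow>
       (\<And>k. k \<in> carrier G \<Longrightarrow> \<exists>y\<in>Y. \<forall>d\<in>D. x (k \<otimes>\<^bsub>G\<^esub> d) = y (k \<otimes>\<^bsub>G\<^esub> d)) \<Longrightarrow> x \<in> Y"
proof -
  obtain F where F: "finite F" "F \<subseteq> finite_patterns G A"
    and Y: "Y = {x \<in> topspace (full_shift G A). \<forall>P\<in>F. \<not> appears_in G P x}"
    using assms unfolding SFT_def by blast
  show thesis
  proof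
    show "finite (\<Union>(fst ` F))" "\<Union>(fst ` F) \<subseteq> carrier G"
      using F by (fastforce simp: finite_patterns_def)+
    fix x assume x: "x \<in> topspace (full_shift G A)"
      and loc: "\<And>k. k \<in> carrier G \<Longrightarrow> \<exists>y\<in>Y. \<forall>d\<in>\<Union>(fst ` F). x (k \<otimes>\<^bsub>G\<^esub> d) = y (k \<otimes>\<^bsub>G\<^esub> d)"
    have "\<not> appears_in G P x" if P: "P \<in> F" for P
    proof
      assume "appears_in G P x"
      then obtain k where k: "k \<in> carrier G" "\<forall>d\<in>fst P. x (k \<otimes>\<^bsub>G\<^esub> d) = snd P d"
        unfolding appears_in_def by blast
      with loc[of k] P obtain y where "y \<in> Y" "\<forall>d\<in>fst P. y (k \<otimes>\<^bsub>G\<^esub> d) = snd P d" by fastforce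
      then show False using Y P k(1) unfolding appears_in_def by blast
    qed
    then show "x \<in> Y" using x Y by blast
  qed
qed

section \<open>Equivariance and block maps given by local rules\<close>

context group
begin

lemma shift_inv_apply: "k \<in> carrier G \<Longrightarrow> h \<in> carrier G \<Longrightarrow> shift G (inv k) x h = x (k \<otimes> h)"
  by (simp add: shift_def)

lemma shift_in_full_shift:
  "k \<in> carrier G \<Longrightarrow> x \<in> topspace (full_shift G A) \<Longrightarrow> shift G k x \<in> topspace (full_shift G A)"
  by (auto simp: full_shift_def shift_def PiE_iff)

text \<open>Shifting by \<open>inv k\<close> brings coordinate \<open>k\<close> to the identity,
  where the local rule \<open>F\<close> is read. Equivariance holds because coordinate
  \<open>k\<close> of a configuration shifted by \<open>g\<close> is coordinate
  \<open>inv g \<otimes> k\<close> of the original one.\<close>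

lemma block_map_local_rule:
  assumes X: "subshift G B X"
    and F: "continuous_map (subtopology (full_shift G B) X) (discrete_topology A) F"
  shows "block_map G B X A (topspace (full_shift G A)) (\<lambda>x. \<lambda>k\<in>carrier G. F (shift G (inv k) x))"
proof -
  let ?X = "subtopology (full_shift G B) X"
  have tX: "topspace ?X = X" using X by (rule topspace_subshift)
  have shift_cont: "continuous_map ?X ?X (shift G g)" if g: "g \<in> carrier G" for g
  proof -
    have "continuous_map ?X (full_shift G B) (shift G g)"
      unfolding continuous_map_into_full_shift
    proof (intro conjI ballI)
      show "shift G g \<in> topspace ?X \<rightarrow> extensional (carrier G)"
        by (auto simp: shift_def)
      fix k assume k: "k \<in> carrier G"
      have "continuous_map ?X (discrete_topology B) (\<lambda>x. x (inv g \<otimes> k))"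
        using g k by (intro continuous_map_from_subtopology continuous_map_full_shift_eval) auto
      then show "continuous_map ?X (discrete_topology B) (\<lambda>x. shift G g x k)"
        using k by (simp add: shift_def)
    qed
    then show ?thesis
      using subshift_shift[OF X g] by (auto simp: continuous_map_in_subtopology tX)
  qed
  have "continuous_map ?X (full_shift G A) (\<lambda>x. \<lambda>k\<in>carrier G. F (shift G (inv k) x))"
    unfolding continuous_map_into_full_shift
    using continuous_map_compose[OF shift_cont F] by (auto simp: o_def)
  moreover have "(\<lambda>k\<in>carrier G. F (shift G (inv k) (shift G g x)))
      = shift G g (\<lambda>k\<in>carrier G. F (shift G (inv k) x))"
    if g: "g \<in> carrier G" and "x \<in> X" for g x
  proof -
    have "shift G (inv k) (shift G g x) = shift G (inv (inv g \<otimes> k)) x" if "k \<in> carrier G" for k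
      using g that by (auto simp: shift_def fun_eq_iff inv_mult_group m_assoc)
    then show ?thesis using g by (simp add: shift_def[of G g "restrict _ _"] cong: restrict_cong)
  qed
  ultimately show ?thesis
    by (simp add: block_map_def equivariant_map_def tX subtopology_topspace)
qed

lemma
  assumes "subshift G B X" "block_map G B X A Y f"
  shows block_map_in: "x \<in> X \<Longrightarrow> f x \<in> Y"
    and block_map_in_topspace: "x \<in> X \<Longrightarrow> f x \<in> topspace (full_shift G A)"
    and block_map_shift: "x \<in> X \<Longrightarrow> g \<in> carrier G \<Longrightarrow> f (shift G g x) = shift G g (f x)"
    and continuous_map_block_map_eval: "k \<in> carrier G \<Longrightarrow>
      continuous_map (subtopology (full_shift G B) X) (discrete_topology A) (\<lambda>x. f x k)"
proof -
  note tX = topspace_subshift[OF assms(1)]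
  have f: "continuous_map (subtopology (full_shift G B) X) (full_shift G A) f" "f \<in> X \<rightarrow> Y"
    "\<forall>g\<in>carrier G. \<forall>x\<in>X. f (shift G g x) = shift G g (f x)"
    using assms(2) unfolding block_map_def equivariant_map_def continuous_map_in_subtopology tX by blast+
  then show "x \<in> X \<Longrightarrow> f x \<in> Y" "x \<in> X \<Longrightarrow> g \<in> carrier G \<Longrightarrow> f (shift G g x) = shift G g (f x)"
    by blast+
  show "x \<in> X \<Longrightarrow> f x \<in> topspace (full_shift G A)"
    using continuous_map_funspace[OF f(1)] unfolding tX by blast
  show "k \<in> carrier G \<Longrightarrow> continuous_map (subtopology (full_shift G B) X) (discrete_topology A) (\<lambda>x. f x k)"
    using f(1) by (simp add: continuous_map_into_full_shift)
qed

section \<open>Construction of the factor map\<close>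

lemma factor_map_if_contractible_SFT:
  assumes fin: "finite A" and SFT: "SFT G A Y" and contr: "contractible_subshift G A Y"
    and X: "subshift G B X"
    and f: "block_map G B X A Y f"
    and g: "block_map G B X A (topspace (full_shift G A)) g" and gY: "Y \<subseteq> g ` X"
  obtains \<phi> where "factor_map G B X A Y \<phi>"
proof -
  let ?X = "subtopology (full_shift G B) X" and ?Y = "subtopology (full_shift G A) Y"
  let ?I = "full_shift G {0, 1 :: nat}"
  have Y: "subshift G A Y" using SFT by (simp add: SFT_def)
  have tX: "topspace ?X = X" and tY: "topspace ?Y = Y"
    using X Y topspace_subshift by blast+
  obtain h where h_map: "equivariant_map G (prod_topology ?I (prod_topology ?Y ?Y))
          (\<lambda>g (i, x, y). (shift G g i, shift G g x, shift G g y)) ?Y (shift G) h"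
    and h0: "\<And>x y. x \<in> Y \<Longrightarrow> y \<in> Y \<Longrightarrow> h ((\<lambda>_\<in>carrier G. 0), x, y) = x"
    and h1: "\<And>x y. x \<in> Y \<Longrightarrow> y \<in> Y \<Longrightarrow> h ((\<lambda>_\<in>carrier G. 1), x, y) = y"
    using contr unfolding contractible_subshift_def by (elim conjE exE) blast
  have h_cont: "continuous_map (prod_topology ?I (prod_topology ?Y ?Y)) (full_shift G A) h"
    and h_in: "\<And>i x y. i \<in> topspace ?I \<Longrightarrow> x \<in> Y \<Longrightarrow> y \<in> Y \<Longrightarrow> h (i, x, y) \<in> Y"
    and h_shift: "\<And>k i x y. k \<in> carrier G \<Longrightarrow> i \<in> topspace ?I \<Longrightarrow> x \<in> Y \<Longrightarrow> y \<in> Y \<Longrightarrow>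
      h (shift G k i, shift G k x, shift G k y) = shift G k (h (i, x, y))"
    using h_map unfolding equivariant_map_def continuous_map_in_subtopology topspace_prod_topology tY
    by (auto simp del: topspace_subtopology)
  \<comment> \<open>A window for the coordinate at the identity suffices: equivariance of
    \<open>h\<close> translates it to every \<open>k\<close> in \<open>h_local\<close>.\<close>
  have "continuous_map (prod_topology ?I (prod_topology ?Y ?Y)) (discrete_topology A) (\<lambda>t. h t \<one>)"
    using h_cont by (simp add: continuous_map_into_full_shift)
  from finite_window_triple[OF finite_insert[THEN iffD2, OF finite.insertI[OF finite.emptyI]] fin Y this]
  obtain N where N: "finite N" "N \<subseteq> carrier G"
    and hN: "\<And>i j x x' y y'. \<lbrakk>i \<in> topspace ?I; j \<in> topspace ?I; x \<in> Y; x' \<in> Y; y \<in> Y; y' \<in> Y;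
       \<And>n. n \<in> N \<Longrightarrow> i n = j n \<and> x n = x' n \<and> y n = y' n\<rbrakk> \<Longrightarrow> h (i, x, y) \<one> = h (j, x', y') \<one>"
    by blast
  have h_local: "h (i, x, y) k = h (j, x', y') k"
    if "i \<in> topspace ?I" "j \<in> topspace ?I" "x \<in> Y" "x' \<in> Y" "y \<in> Y" "y' \<in> Y" and k: "k \<in> carrier G"
      and "\<And>n. n \<in> N \<Longrightarrow> i (k \<otimes> n) = j (k \<otimes> n) \<and> x (k \<otimes> n) = x' (k \<otimes> n) \<and> y (k \<otimes> n) = y' (k \<otimes> n)"
    for i j x x' y y' k
  proof -
    let ?s = "shift G (inv k)"
    have "h (i, x, y) k = h (?s i, ?s x, ?s y) \<one>"
      using that by (simp add: h_shift shift_inv_apply)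
    also have "\<dots> = h (?s j, ?s x', ?s y') \<one>"
      using that N(2) by (intro hN) (auto simp: shift_in_full_shift subshift_shift[OF Y] shift_inv_apply subset_iff)
    also have "\<dots> = h (j, x', y') k"
      using that by (simp add: h_shift shift_inv_apply)
    finally show ?thesis .
  qed
  obtain D where D: "finite D" "D \<subseteq> carrier G"
    and SFT_D: "\<And>x. x \<in> topspace (full_shift G A) \<Longrightarrow>
       (\<And>k. k \<in> carrier G \<Longrightarrow> \<exists>y\<in>Y. \<forall>d\<in>D. x (k \<otimes> d) = y (k \<otimes> d)) \<Longrightarrow> x \<in> Y"
    using SFT_window[OF SFT] by blast
  \<comment> \<open>\<open>E\<close> is the product set \<open>DN\<close>: the values of
    \<open>h\<close> on \<open>kD\<close> read their arguments on \<open>kE\<close>.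
    \<open>M\<close> consists of all quotients \<open>inv a \<otimes> b\<close> of elements of
    \<open>E\<close>, so that \<open>eM\<close> contains \<open>E\<close> for every
    \<open>e \<in> E\<close>. A match on \<open>M\<close> centred at any point of \<open>kE\<close>
    then covers all of \<open>kE\<close>.\<close>
  define E where "E = (\<lambda>(d, n). d \<otimes> n) ` (D \<times> N)"
  define M where "M = (\<lambda>(a, b). inv a \<otimes> b) ` (E \<times> E)"
  have E: "finite E" "E \<subseteq> carrier G" using D N by (auto simp: E_def)
  have M: "finite M" "M \<subseteq> carrier G" using E by (auto simp: M_def)

  define near where "near W z \<longleftrightarrow> (\<exists>y\<in>Y. \<forall>w\<in>W. z w = y w)" for W z
  \<comment> \<open>By shift invariance of \<open>Y\<close>, a match at the identity after shifting
    back is the same as a match on the translated window \<open>kW\<close>.\<close>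
  have near_shift: "near W (shift G (inv k) z) \<longleftrightarrow> (\<exists>y\<in>Y. \<forall>w\<in>W. z (k \<otimes> w) = y (k \<otimes> w))"
    if k: "k \<in> carrier G" and W: "W \<subseteq> carrier G" for k W z
  proof
    assume "near W (shift G (inv k) z)"
    then obtain y where y: "y \<in> Y" "\<forall>w\<in>W. z (k \<otimes> w) = y w"
      using k W by (auto simp: near_def shift_inv_apply subset_iff)
    have "\<forall>w\<in>W. z (k \<otimes> w) = shift G k y (k \<otimes> w)"
      using y k W by (auto simp: shift_def m_assoc[symmetric] subset_iff)
    then show "\<exists>y\<in>Y. \<forall>w\<in>W. z (k \<otimes> w) = y (k \<otimes> w)"
      using subshift_shift[OF Y k y(1)] by blast
  next
    assume "\<exists>y\<in>Y. \<forall>w\<in>W. z (k \<otimes> w) = y (k \<otimes> w)"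
    then obtain y where y: "y \<in> Y" "\<forall>w\<in>W. z (k \<otimes> w) = y (k \<otimes> w)" by blast
    then show "near W (shift G (inv k) z)"
      unfolding near_def using subshift_shift[OF Y _ y(1), of "inv k"] k W
      by (intro bexI[of _ "shift G (inv k) y"]) (auto simp: shift_inv_apply subset_iff)
  qed

  define i where "i x = (\<lambda>k\<in>carrier G. if near M (g (shift G (inv k) x)) then 1 else 0 :: nat)" for x
  have i_map: "block_map G B X {0, 1} (topspace ?I) i"
    unfolding i_def
  proof (rule block_map_local_rule[OF X])
    show "continuous_map ?X (discrete_topology {0, 1}) (\<lambda>x. if near M (g x) then 1 else 0)"
    proof (rule continuous_map_discrete_if_finitely_determined[OF M(1), where u = "\<lambda>m x. g x m" and C = "\<lambda>_. A"])
      show "continuous_map ?X (discrete_topology A) (\<lambda>x. g x m)" if "m \<in> M" for m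
        using that M by (intro continuous_map_block_map_eval[OF X g]) auto
      fix x x' assume "\<And>m. m \<in> M \<Longrightarrow> g x m = g x' m"
      then show "(if near M (g x) then 1 else 0) = (if near M (g x') then 1 else 0)"
        by (auto simp: near_def)
    qed auto
  qed
  note i_in = block_map_in_topspace[OF X i_map]
  have i_apply: "i x k = (if \<exists>y\<in>Y. \<forall>m\<in>M. g x (k \<otimes> m) = y (k \<otimes> m) then 1 else 0)"
    if "x \<in> X" "k \<in> carrier G" for x k
    using that by (simp add: i_def block_map_shift[OF X g] near_shift M)

  \<comment> \<open>An arbitrary choice, equivariant or not, is harmless: \<open>h\<close> at the
    identity reads its arguments only on \<open>N\<close>, where all admissible choices agree with
    \<open>z\<close>.\<close>
  define pick where "pick z = (SOME y. y \<in> Y \<and> (\<forall>n\<in>N. z n = y n))" for z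
  have "pick z \<in> Y \<and> (\<forall>n\<in>N. z n = pick z n)" if "near N z" for z
    unfolding pick_def
    by (rule someI_ex[of "\<lambda>y. y \<in> Y \<and> (\<forall>n\<in>N. z n = y n)"]) (use that in \<open>unfold near_def, blast\<close>)
  then have pick: "pick z \<in> Y" "n \<in> N \<Longrightarrow> pick z n = z n" if "near N z" for z n
    using that by auto
  define H where "H x = (if near N (g x) then h (i x, f x, pick (g x)) \<one> else f x \<one>)" for x
  define \<phi> where "\<phi> x = (\<lambda>k\<in>carrier G. H (shift G (inv k) x))" for x
  \<comment> \<open>The chosen point may be replaced by any \<open>y \<in> Y\<close> matching
    \<open>g x\<close> on \<open>kN\<close>. This allows one and the same \<open>y\<close> to be
    used at several coordinates below.\<close>
  have \<phi>_near: "\<phi> x k = h (i x, f x, y) k"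
    if x: "x \<in> X" and k: "k \<in> carrier G" and y: "y \<in> Y" "\<And>n. n \<in> N \<Longrightarrow> g x (k \<otimes> n) = y (k \<otimes> n)"
    for x k y
  proof -
    let ?s = "shift G (inv k)"
    have sx: "?s x \<in> X" and sy: "?s y \<in> Y"
      using x k y X Y by (auto intro: subshift_shift)
    have near: "near N (g (?s x))"
      using x k y N by (auto simp: block_map_shift[OF X g] near_shift)
    have "\<phi> x k = h (i (?s x), f (?s x), pick (g (?s x))) \<one>"
      using near k by (simp add: \<phi>_def H_def)
    also have "\<dots> = h (i (?s x), f (?s x), ?s y) \<one>"
    proof (rule hN)
      fix n assume n: "n \<in> N"
      have "pick (g (?s x)) n = ?s y n"
        using pick(2)[OF near n] x y(2)[OF n] k n N by (auto simp: block_map_shift[OF X g] shift_inv_apply subset_iff)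
      then show "i (?s x) n = i (?s x) n \<and> f (?s x) n = f (?s x) n \<and> pick (g (?s x)) n = ?s y n"
        by simp
    qed (use sx sy near pick i_in block_map_in[OF X f] in auto)
    also have "\<dots> = h (i x, f x, y) k"
      using x y k i_in block_map_in[OF X f]
      by (simp add: block_map_shift[OF X i_map] block_map_shift[OF X f] h_shift shift_inv_apply)
    finally show ?thesis .
  qed
  have \<phi>_far: "\<phi> x k = f x k" if x: "x \<in> X" and k: "k \<in> carrier G"
    and far: "\<not> (\<exists>y\<in>Y. \<forall>n\<in>N. g x (k \<otimes> n) = y (k \<otimes> n))" for x k
  proof -
    have "\<not> near N (g (shift G (inv k) x))"
      using x k far N by (simp add: block_map_shift[OF X g] near_shift)
    then show ?thesis
      using x k by (simp add: \<phi>_def H_def block_map_shift[OF X f] shift_inv_apply)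
  qed
  \<comment> \<open>If \<open>g x\<close> matches \<open>Y\<close> on \<open>kN\<close>, then
    locality allows \<open>i x\<close> to be replaced by the constant 0, where \<open>h\<close>
    returns its first point \<open>f x\<close>. Otherwise \<open>f x\<close> is the default
    value.\<close>
  have \<phi>_zero: "\<phi> x k = f x k" if x: "x \<in> X" and k: "k \<in> carrier G"
    and zero: "\<And>n. n \<in> N \<Longrightarrow> i x (k \<otimes> n) = 0" for x k
  proof (cases "\<exists>y\<in>Y. \<forall>n\<in>N. g x (k \<otimes> n) = y (k \<otimes> n)")
    case True
    then obtain y where y: "y \<in> Y" "\<And>n. n \<in> N \<Longrightarrow> g x (k \<otimes> n) = y (k \<otimes> n)" by blast
    have "h (i x, f x, y) k = h ((\<lambda>_\<in>carrier G. 0), f x, y) k"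
      using x k y zero N i_in block_map_in[OF X f]
      by (intro h_local) (auto simp: full_shift_def subset_iff)
    then show ?thesis
      using \<phi>_near[OF x k y] h0 block_map_in[OF X f x] y(1) by simp
  qed (rule \<phi>_far[OF x k])

  \<comment> \<open>The window is \<open>N\<close> together with the identity, since the default
    branch reads \<open>f x\<close> at the identity. The letters read are those of
    \<open>i x\<close>, \<open>f x\<close> and \<open>g x\<close>, each a continuous function of
    \<open>x\<close>.\<close>
  have H_cont: "continuous_map ?X (discrete_topology A) H"
  proof (rule continuous_map_discrete_if_finitely_determined[where N = "insert \<one> N"
        and u = "\<lambda>n x. (i x n, f x n, g x n)" and C = "\<lambda>_. {0, 1} \<times> A \<times> A"])
    fix n assume "n \<in> insert \<one> N"
    then have n: "n \<in> carrier G" using N by auto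
    then show "continuous_map ?X (discrete_topology ({0, 1} \<times> A \<times> A)) (\<lambda>x. (i x n, f x n, g x n))"
      unfolding prod_topology_discrete_topology
      by (intro continuous_map_pairedI continuous_map_block_map_eval[OF X i_map]
          continuous_map_block_map_eval[OF X f] continuous_map_block_map_eval[OF X g])
  next
    fix x x' assume x: "x \<in> topspace ?X" "x' \<in> topspace ?X"
      and "\<And>n. n \<in> insert \<one> N \<Longrightarrow> (i x n, f x n, g x n) = (i x' n, f x' n, g x' n)"
    then have eq: "\<And>n. n \<in> insert \<one> N \<Longrightarrow> i x n = i x' n \<and> f x n = f x' n \<and> g x n = g x' n" by blast
    have "near N (g x) \<longleftrightarrow> near N (g x')" using eq by (auto simp: near_def)
    moreover have "h (i x, f x, pick (g x)) \<one> = h (i x', f x', pick (g x')) \<one>" if "near N (g x)" "near N (g x')"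
      using x that eq i_in block_map_in[OF X f] pick unfolding tX by (intro hN) auto
    ultimately show "H x = H x'" using eq by (auto simp: H_def)
  next
    have "y \<one> \<in> A" if "y \<in> Y" for y
      using subshift_topspace[OF Y] that by (auto simp: full_shift_def)
    then show "H \<in> topspace ?X \<rightarrow> A"
      using i_in block_map_in[OF X f] pick h_in unfolding tX H_def by auto
  qed (use N in auto)
  have \<phi>_map: "block_map G B X A (topspace (full_shift G A)) \<phi>"
    unfolding \<phi>_def by (rule block_map_local_rule[OF X H_cont])

  have \<phi>_in: "\<phi> x \<in> Y" if x: "x \<in> X" for x
  proof (rule SFT_D)
    show "\<phi> x \<in> topspace (full_shift G A)" using \<phi>_map x by (rule block_map_in[OF X])
    fix k assume k: "k \<in> carrier G"
    show "\<exists>y\<in>Y. \<forall>d\<in>D. \<phi> x (k \<otimes> d) = y (k \<otimes> d)"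
    \<comment> \<open>If \<open>i x\<close> vanishes on \<open>kE\<close>, the image equals
      \<open>f x\<close> on \<open>kD\<close>. A single nonzero value on \<open>kE\<close> instead
      provides one point \<open>y\<close> valid on the whole of \<open>kE\<close>.\<close>
    proof (cases "\<forall>e\<in>E. i x (k \<otimes> e) = 0")
      case True
      have "\<phi> x (k \<otimes> d) = f x (k \<otimes> d)" if "d \<in> D" for d
      proof (rule \<phi>_zero[OF x])
        fix n assume n: "n \<in> N"
        then have "d \<otimes> n \<in> E" using that by (auto simp: E_def)
        then show "i x (k \<otimes> d \<otimes> n) = 0"
          using True k subsetD[OF D(2) that] subsetD[OF N(2) n] by (simp add: m_assoc)
      qed (use k that D in auto)
      then show ?thesis using block_map_in[OF X f x] by blast
    next
      case False
      then obtain e where e: "e \<in> E" "i x (k \<otimes> e) \<noteq> 0" by blast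
      then obtain y where y: "y \<in> Y" "\<forall>m\<in>M. g x (k \<otimes> e \<otimes> m) = y (k \<otimes> e \<otimes> m)"
        using i_apply[OF x, of "k \<otimes> e"] k E by (metis m_closed subsetD)
      \<comment> \<open>The match found around \<open>k \<otimes> e\<close> extends to
        \<open>kE\<close> because \<open>E\<close> is contained in \<open>eM\<close>.\<close>
      have yE: "g x (k \<otimes> e') = y (k \<otimes> e')" if "e' \<in> E" for e'
      proof -
        have "inv e \<otimes> e' \<in> M" using e that by (auto simp: M_def)
        moreover have "k \<otimes> e \<otimes> (inv e \<otimes> e') = k \<otimes> e'"
          using k subsetD[OF E(2) e(1)] subsetD[OF E(2) that] by (simp add: m_assoc[of k e] m_assoc[of e, symmetric])
        ultimately show ?thesis using y(2) by force
      qed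
      \<comment> \<open>Since \<open>y\<close> does not depend on \<open>d\<close>, the image on
        \<open>kD\<close> is a piece of the single point \<open>h (i x, f x, y)\<close> of
        \<open>Y\<close>.\<close>
      have "\<phi> x (k \<otimes> d) = h (i x, f x, y) (k \<otimes> d)" if "d \<in> D" for d
      proof (rule \<phi>_near[OF x _ y(1)])
        fix n assume n: "n \<in> N"
        then have "d \<otimes> n \<in> E" using that by (auto simp: E_def)
        then show "g x (k \<otimes> d \<otimes> n) = y (k \<otimes> d \<otimes> n)"
          using yE[of "d \<otimes> n"] k subsetD[OF D(2) that] subsetD[OF N(2) n] by (simp add: m_assoc)
      qed (use k that D in auto)
      then show ?thesis using h_in[OF i_in[OF x] block_map_in[OF X f x] y(1)] by blast
    qed
  qed
  moreover have "y \<in> \<phi> ` X" if y: "y \<in> Y" for y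
  proof -
    obtain x where x: "x \<in> X" "g x = y" using gY y by blast
    \<comment> \<open>Here \<open>g x = y\<close> lies in \<open>Y\<close> and is itself the
      matching point at every coordinate, so \<open>h\<close> is evaluated at the constant 1 and
      returns \<open>y\<close>.\<close>
    have "i x = (\<lambda>_\<in>carrier G. 1)"
      using x y i_in[OF x(1)] by (intro extensionalityI[of _ "carrier G"]) (auto simp: i_apply full_shift_def PiE_iff)
    then have "\<phi> x k = y k" if "k \<in> carrier G" for k
      using \<phi>_near[OF x(1) that y] x h1 y block_map_in[OF X f] by auto
    then have "\<phi> x = y"
      using \<phi>_in[OF x(1)] y subshift_topspace[OF Y]
      by (intro extensionalityI[of _ "carrier G"]) (auto simp: full_shift_def PiE_iff)
    then show ?thesis using x by blast
  qed
  ultimately have "factor_map G B X A Y \<phi>"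
    using \<phi>_map tX by (auto simp: factor_map_def block_map_def equivariant_map_def continuous_map_in_subtopology)
  then show thesis by (rule that)
qed

end

theorem theorem1p7:
  fixes G :: "('g, 'm) monoid_scheme"
    and A :: "'a set" and B :: "'b set"
    and X :: "('g \<Rightarrow> 'b) set" and Y :: "('g \<Rightarrow> 'a) set"
  assumes "group G"
    and "finite A" and "finite B"
    and "SFT G A Y" and "contractible_subshift G A Y"
    and "subshift G B X"
  shows "((\<exists>f. block_map G B X A Y f) \<and>
          (\<exists>g. block_map G B X A (topspace (full_shift G A)) g \<and> Y \<subseteq> g ` X))
         \<longleftrightarrow> (\<exists>f. factor_map G B X A Y f)"
proof
  assume "(\<exists>f. block_map G B X A Y f) \<and>
          (\<exists>g. block_map G B X A (topspace (full_shift G A)) g \<and> Y \<subseteq> g ` X)"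
  then obtain f g where f: "block_map G B X A Y f"
    and g: "block_map G B X A (topspace (full_shift G A)) g" "Y \<subseteq> g ` X" by blast
  show "\<exists>f. factor_map G B X A Y f"
    by (rule group.factor_map_if_contractible_SFT[OF assms(1,2,4,5,6) f g]) (rule exI)
next
  assume "\<exists>f. factor_map G B X A Y f"
  then obtain f where f: "block_map G B X A Y f" "f ` X = Y"
    by (auto simp: factor_map_def)
  \<comment> \<open>A factor map serves as both maps: enlarging the codomain from \<open>Y\<close>
    to the full shift keeps continuity and equivariance.\<close>
  then have "block_map G B X A (topspace (full_shift G A)) f"
    by (auto simp: block_map_def equivariant_map_def continuous_map_in_subtopology)
  with f show "(\<exists>f. block_map G B X A Y f) \<and>
          (\<exists>g. block_map G B X A (topspace (full_shift G A)) g \<and> Y \<subseteq> g ` X)"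
    by blast
qed

end
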